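(* Let $H$ be a group and let $f:H\to H$ be a monomorphism such that $f(H)$ has finite index in $H$. Then $H$ and $f(H)$ are quasi-normal subgroups of the ascending HNN extension $G=H\ast_f$.
   Context: For a subgroup $H$ of a group $G$, the commensurator of $H$ in $G$ is $Comm(H,G)=\{g\in G : gHg^{-1}\cap H \text{ has finite index in both } H \text{ and } gHg^{-1}\}$. A subgroup $Q$ of $G$ is quasi-normal in $G$ if $Comm(Q,G)=G$. The ascending HNN extension $H\ast_f$ is the group $\langle t,H : t^{-1}ht=f(h) \text{ for all } h\in H\rangle$; $H$ is identified with its (injective) image in $H\ast_f$. *)

theory Defs
  imports "HOL-Algebra.Coset" "HOL-Library.Countable_Set"
begin

definition conj_subgroup :: "('a, 'b) monoid_scheme \<Rightarrow> 'a \<Rightarrow> 'a set \<Rightarrow> 'a set"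
  where "conj_subgroup G g K = (\<lambda>h. g \<otimes>\<^bsub>G\<^esub> h \<otimes>\<^bsub>G\<^esub> inv\<^bsub>G\<^esub> g) ` K"

text \<open>\<open>finite_index K L G\<close>: \<open>K\<close> is a subgroup of finite index of the subgroup \<open>L\<close> of \<open>G\<close>.\<close>

definition finite_index :: "'a set \<Rightarrow> 'a set \<Rightarrow> ('a, 'b) monoid_scheme \<Rightarrow> bool"
  where "finite_index K L G \<longleftrightarrow>
    subgroup L G \<and> subgroup K (G\<lparr>carrier := L\<rparr>) \<and> finite (rcosets\<^bsub>G\<lparr>carrier := L\<rparr>\<^esub> K)"

definition commensurator :: "'a set \<Rightarrow> ('a, 'b) monoid_scheme \<Rightarrow> 'a set"
  where "commensurator K G = {g \<in> carrier G.
    finite_index (conj_subgroup G g K \<inter> K) K G \<and>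
    finite_index (conj_subgroup G g K \<inter> K) (conj_subgroup G g K) G}"

definition quasi_normal :: "'a set \<Rightarrow> ('a, 'b) monoid_scheme \<Rightarrow> bool"
  where "quasi_normal Q G \<longleftrightarrow> subgroup Q G \<and> commensurator Q G = carrier G"


text \<open>The letter \<open>(x, True)\<close> stands for the generator \<open>x\<close> and \<open>(x, False)\<close> for its formal inverse.
  A relation \<open>u = v\<close> is the pair of words \<open>(u, v)\<close>.\<close>

type_synonym 'g word = "('g \<times> bool) list"

definition words :: "'g set \<Rightarrow> 'g word set"
  where "words S = lists (S \<times> UNIV)"

inductive_set pres_rel :: "'g set \<Rightarrow> ('g word \<times> 'g word) set \<Rightarrow> ('g word \<times> 'g word) set"
  for S R
  where
    refl: "w \<in> words S \<Longrightarrow> (w, w) \<in> pres_rel S R"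
  | sym: "(u, v) \<in> pres_rel S R \<Longrightarrow> (v, u) \<in> pres_rel S R"
  | trans: "(u, v) \<in> pres_rel S R \<Longrightarrow> (v, w) \<in> pres_rel S R \<Longrightarrow> (u, w) \<in> pres_rel S R"
  | append: "(u, v) \<in> pres_rel S R \<Longrightarrow> (u', v') \<in> pres_rel S R \<Longrightarrow> (u @ u', v @ v') \<in> pres_rel S R"
  | cancel: "x \<in> S \<Longrightarrow> ([(x, b), (x, \<not> b)], []) \<in> pres_rel S R"
  | relator: "(u, v) \<in> R \<Longrightarrow> u \<in> words S \<Longrightarrow> v \<in> words S \<Longrightarrow> (u, v) \<in> pres_rel S R"

definition pres_class :: "'g set \<Rightarrow> ('g word \<times> 'g word) set \<Rightarrow> 'g word \<Rightarrow> 'g word set"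
  where "pres_class S R w = pres_rel S R `` {w}"

definition presented_group :: "'g set \<Rightarrow> ('g word \<times> 'g word) set \<Rightarrow> 'g word set monoid"
  where "presented_group S R =
    \<lparr>carrier = words S // pres_rel S R,
     monoid.mult = (\<lambda>A B. \<Union>u\<in>A. \<Union>v\<in>B. pres_class S R (u @ v)),
     one = pres_class S R []\<rparr>"

lemma pres_rel_words: "(u, v) \<in> pres_rel S R \<Longrightarrow> u \<in> words S \<and> v \<in> words S"
  by (induction rule: pres_rel.induct) (auto simp: words_def)

lemma equiv_pres_rel: "equiv (words S) (pres_rel S R)"
proof (rule equivI)
  show "pres_rel S R \<subseteq> words S \<times> words S" by (auto dest: pres_rel_words)
  show "refl_on (words S) (pres_rel S R)"
    by (simp add: refl_on_def pres_rel.refl)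
  show "sym (pres_rel S R)" by (rule symI) (rule pres_rel.sym)
  show "trans (pres_rel S R)" by (rule transI) (rule pres_rel.trans)
qed

lemma pres_class_eq_iff:
  "u \<in> words S \<Longrightarrow> v \<in> words S \<Longrightarrow> pres_class S R u = pres_class S R v \<longleftrightarrow> (u, v) \<in> pres_rel S R"
  unfolding pres_class_def by (rule eq_equiv_class_iff[OF equiv_pres_rel])

lemma pres_carrier: "carrier (presented_group S R) = pres_class S R ` words S"
  by (auto simp: presented_group_def quotient_def pres_class_def)

lemma pres_mult:
  assumes "u \<in> words S" "v \<in> words S"
  shows "pres_class S R u \<otimes>\<^bsub>presented_group S R\<^esub> pres_class S R v = pres_class S R (u @ v)"
proof -
  have eq: "pres_class S R (u' @ v') = pres_class S R (u @ v)"
    if "u' \<in> pres_class S R u" "v' \<in> pres_class S R v" for u' v'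
  proof -
    have "(u, u') \<in> pres_rel S R" "(v, v') \<in> pres_rel S R"
      using that by (simp_all add: pres_class_def)
    from pres_rel.sym[OF pres_rel.append[OF this]] show ?thesis
      unfolding pres_class_def by (rule equiv_class_eq[OF equiv_pres_rel])
  qed
  have "u \<in> pres_class S R u" "v \<in> pres_class S R v"
    using assms by (simp_all add: pres_class_def pres_rel.refl)
  hence "(\<Union>u'\<in>pres_class S R u. \<Union>v'\<in>pres_class S R v. pres_class S R (u' @ v')) = pres_class S R (u @ v)"
    using eq by blast
  thus ?thesis by (simp add: presented_group_def)
qed

lemma pres_one: "\<one>\<^bsub>presented_group S R\<^esub> = pres_class S R []"
  by (simp add: presented_group_def)

lemma words_append [simp]: "u @ v \<in> words S \<longleftrightarrow> u \<in> words S \<and> v \<in> words S"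
  by (auto simp: words_def)

lemma words_Nil [simp]: "[] \<in> words S"
  by (simp add: words_def)

lemma words_Cons [simp]: "a # w \<in> words S \<longleftrightarrow> fst a \<in> S \<and> w \<in> words S"
  by (cases a) (auto simp: words_def)

lemma pres_left_inverse:
  assumes "w \<in> words S"
  shows "\<exists>w'\<in>words S. (w' @ w, []) \<in> pres_rel S R"
  using assms
proof (induction w)
  case Nil
  show ?case by (rule bexI[of _ "[]"]) (auto intro: pres_rel.refl)
next
  case (Cons a w)
  obtain x b where a: "a = (x, b)" by (cases a)
  have x: "x \<in> S" and w: "w \<in> words S" using Cons.prems a by simp_all
  obtain w' where w': "w' \<in> words S" "(w' @ w, []) \<in> pres_rel S R" using Cons.IH[OF w] by blast
  have "([(x, \<not> b), (x, b)] @ w, [] @ w) \<in> pres_rel S R"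
    using pres_rel.append[OF pres_rel.cancel[OF x, of "\<not> b" R] pres_rel.refl[OF w]] by simp
  hence "(w' @ [(x, \<not> b), (x, b)] @ w, w' @ [] @ w) \<in> pres_rel S R"
    by (rule pres_rel.append[OF pres_rel.refl[OF w'(1)]])
  hence "(w' @ [(x, \<not> b), (x, b)] @ w, []) \<in> pres_rel S R"
    using w'(2) unfolding append_Nil by (rule pres_rel.trans)
  hence "((w' @ [(x, \<not> b)]) @ a # w, []) \<in> pres_rel S R"
    by (simp add: a)
  moreover have "w' @ [(x, \<not> b)] \<in> words S" using w'(1) x by simp
  ultimately show ?case by (rule bexI)
qed

lemma group_presented_group: "group (presented_group S R)"
proof (rule groupI)
  fix A assume "A \<in> carrier (presented_group S R)"
  then obtain w where w: "w \<in> words S" "A = pres_class S R w" by (auto simp: pres_carrier)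
  obtain w' where w': "w' \<in> words S" "(w' @ w, []) \<in> pres_rel S R"
    using pres_left_inverse[OF w(1)] by blast
  hence "pres_class S R w' \<otimes>\<^bsub>presented_group S R\<^esub> A = \<one>\<^bsub>presented_group S R\<^esub>"
    using w by (simp add: pres_mult pres_one pres_class_eq_iff)
  thus "\<exists>Y\<in>carrier (presented_group S R). Y \<otimes>\<^bsub>presented_group S R\<^esub> A = \<one>\<^bsub>presented_group S R\<^esub>"
    using w' by (auto simp: pres_carrier)
qed (auto simp: pres_carrier pres_one pres_mult)


datatype 'a hnn_gen = Base 'a | Stable

definition hnn_gens :: "('a, 'b) monoid_scheme \<Rightarrow> 'a hnn_gen set"
  where "hnn_gens H = insert Stable (Base ` carrier H)"

text \<open>As usual, listing the group \<open>H\<close> in a presentation means taking all its elements as generators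
  and its multiplication table as relations.\<close>

definition hnn_rels :: "('a, 'b) monoid_scheme \<Rightarrow> ('a \<Rightarrow> 'a) \<Rightarrow> ('a hnn_gen word \<times> 'a hnn_gen word) set"
  where "hnn_rels H f =
    {([(Base h, True), (Base h', True)], [(Base (h \<otimes>\<^bsub>H\<^esub> h'), True)]) | h h'.
       h \<in> carrier H \<and> h' \<in> carrier H} \<union>
    {([(Stable, False), (Base h, True), (Stable, True)], [(Base (f h), True)]) | h. h \<in> carrier H}"

definition ascending_HNN :: "('a, 'b) monoid_scheme \<Rightarrow> ('a \<Rightarrow> 'a) \<Rightarrow> 'a hnn_gen word set monoid"
  where "ascending_HNN H f = presented_group (hnn_gens H) (hnn_rels H f)"

definition hnn_base :: "('a, 'b) monoid_scheme \<Rightarrow> ('a \<Rightarrow> 'a) \<Rightarrow> 'a \<Rightarrow> 'a hnn_gen word set"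
  where "hnn_base H f h = pres_class (hnn_gens H) (hnn_rels H f) [(Base h, True)]"

lemma group_ascending_HNN: "group (ascending_HNN H f)"
  by (simp add: ascending_HNN_def group_presented_group)

lemma hnn_base_hom:
  assumes "group H"
  shows "hnn_base H f \<in> hom H (ascending_HNN H f)"
proof (rule homI)
  interpret group H by fact
  fix h assume h: "h \<in> carrier H"
  thus "hnn_base H f h \<in> carrier (ascending_HNN H f)"
    by (auto simp: hnn_base_def ascending_HNN_def pres_carrier hnn_gens_def)
  fix h' assume h': "h' \<in> carrier H"
  have "([(Base h, True), (Base h', True)], [(Base (h \<otimes>\<^bsub>H\<^esub> h'), True)])
          \<in> pres_rel (hnn_gens H) (hnn_rels H f)"
    by (rule pres_rel.relator) (use h h' in \<open>auto simp: hnn_gens_def hnn_rels_def\<close>)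
  thus "hnn_base H f (h \<otimes>\<^bsub>H\<^esub> h') = hnn_base H f h \<otimes>\<^bsub>ascending_HNN H f\<^esub> hnn_base H f h'"
    using h h' by (simp add: hnn_base_def ascending_HNN_def pres_mult pres_class_eq_iff hnn_gens_def
        pres_rel.sym)
qed

text \<open>Identifying \<open>H\<close> with its image is legitimate. If \<open>f\<close> is injective with image of finite index,
  left multiplication on \<open>carrier H \<times> UNIV\<close> is isomorphic to its twist by \<open>f\<close>, and letting \<open>Stable\<close>
  act by such an isomorphism extends it to an action of \<open>ascending_HNN H f\<close>.\<close>

lemma hnn_base_inj:
  assumes H: "group H" and f: "f \<in> mon H H" and fin: "finite_index (f ` carrier H) (carrier H) H"
  shows "inj_on (hnn_base H f) (carrier H)"
proof -
  interpret group H by fact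
  define K where "K = f ` carrier H"
  define Q where "Q = rcosets\<^bsub>H\<^esub> K"
  define A where "A = carrier H \<times> (UNIV :: nat set)"
  have f_hom: "f (a \<otimes>\<^bsub>H\<^esub> b) = f a \<otimes>\<^bsub>H\<^esub> f b" if "a \<in> carrier H" "b \<in> carrier H" for a b
    using f that by (auto simp: mon_def hom_def)
  have f_closed [simp]: "f a \<in> carrier H" if "a \<in> carrier H" for a
    using f that by (auto simp: mon_def hom_def)
  have f_inj: "inj_on f (carrier H)" using f by (auto simp: mon_def)
  have K: "subgroup K H" and finQ: "finite Q"
    using fin by (auto simp: finite_index_def K_def Q_def)
  have Ksub: "K \<subseteq> carrier H" using K by (rule subgroup.subset)
  define rep where "rep q = (SOME r. r \<in> q)" for q :: "'a set"
  have rep: "rep q \<in> carrier H" "K #>\<^bsub>H\<^esub> rep q = q" if q: "q \<in> Q" for q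
  proof -
    obtain x where x: "x \<in> carrier H" "q = K #>\<^bsub>H\<^esub> x" using q by (auto simp: Q_def RCOSETS_def)
    have "x \<in> q" using x K by (simp add: rcos_self)
    hence r: "rep q \<in> q" unfolding rep_def by (rule someI)
    show "rep q \<in> carrier H" using r x Ksub r_coset_subset_G[OF Ksub x(1)] by auto
    show "K #>\<^bsub>H\<^esub> rep q = q" using r x K repr_independence by metis
  qed
  have "Q \<noteq> {}" by (auto simp: Q_def RCOSETS_def)
  hence "infinite (Q \<times> (UNIV :: nat set))" by (auto dest: finite_cartesian_productD2)
  moreover have "countable (Q \<times> (UNIV :: nat set))" using finQ by (intro countable_SIGMA) (auto intro: countable_finite)
  ultimately have "bij_betw (from_nat_into (Q \<times> (UNIV :: nat set))) UNIV (Q \<times> UNIV)"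
    by (rule bij_betw_from_nat_into[rotated])
  then obtain c :: "nat \<Rightarrow> 'a set \<times> nat" where c: "bij_betw c UNIV (Q \<times> UNIV)" by blast
  have cQ: "fst (c m) \<in> Q" for m using bij_betwE[OF c] by (auto simp: mem_Times_iff)
  define act where "act h = (\<lambda>(x, n :: nat). (h \<otimes>\<^bsub>H\<^esub> x, n))" for h
  define \<sigma> where "\<sigma> = (\<lambda>(a, m). (f a \<otimes>\<^bsub>H\<^esub> rep (fst (c m)), snd (c m)))"
  have \<sigma>A: "\<sigma> y \<in> A" if "y \<in> A" for y
    using that rep(1)[OF cQ] by (auto simp: \<sigma>_def A_def)
  have \<sigma>_bij: "bij_betw \<sigma> A A"
  proof (rule bij_betwI')
    fix y z assume yz: "y \<in> A" "z \<in> A"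
    obtain a m b n where [simp]: "y = (a, m)" "z = (b, n)" by (cases y; cases z)
    have ab: "a \<in> carrier H" "b \<in> carrier H" using yz by (auto simp: A_def)
    show "\<sigma> y = \<sigma> z \<longleftrightarrow> y = z"
    proof
      assume eq: "\<sigma> y = \<sigma> z"
      define p q where "p = fst (c m)" and "q = fst (c n)"
      have pq: "p \<in> Q" "q \<in> Q" using cQ by (auto simp: p_def q_def)
      have eq1: "f a \<otimes>\<^bsub>H\<^esub> rep p = f b \<otimes>\<^bsub>H\<^esub> rep q" and eq2: "snd (c m) = snd (c n)"
        using eq by (auto simp: \<sigma>_def p_def q_def)
      have "K #>\<^bsub>H\<^esub> (f a \<otimes>\<^bsub>H\<^esub> rep p) = p" "K #>\<^bsub>H\<^esub> (f b \<otimes>\<^bsub>H\<^esub> rep q) = q"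
        using pq ab rep Ksub K by (simp_all add: coset_mult_assoc[symmetric] K_def coset_join2)
      hence "p = q" using eq1 by simp
      hence "c m = c n" using eq2 by (simp add: p_def q_def prod_eq_iff)
      hence "m = n" using c by (auto simp: bij_betw_def inj_on_def)
      moreover have "f a = f b"
        using eq1 right_cancel[of "rep q" "f a" "f b"] rep(1)[OF pq(2)] ab \<open>p = q\<close> by simp
      hence "a = b" using f_inj ab by (simp add: inj_on_eq_iff)
      ultimately show "y = z" by simp
    qed simp
  next
    fix z assume "z \<in> A"
    then obtain x n where z: "z = (x, n)" and x: "x \<in> carrier H" by (auto simp: A_def)
    define q where "q = K #>\<^bsub>H\<^esub> x"
    have q: "q \<in> Q" using x by (auto simp: Q_def q_def RCOSETS_def)
    have "x \<in> K #>\<^bsub>H\<^esub> rep q" using rep(2)[OF q] x K by (simp add: q_def rcos_self)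
    then obtain a where a: "a \<in> carrier H" "x = f a \<otimes>\<^bsub>H\<^esub> rep q" by (auto simp: r_coset_def K_def)
    obtain m where m: "c m = (q, n)"
      using c q by (metis UNIV_I SigmaI bij_betw_imp_surj_on imageE)
    show "\<exists>y\<in>A. z = \<sigma> y"
      by (rule bexI[of _ "(a, m)"]) (use a m z in \<open>auto simp: \<sigma>_def A_def\<close>)
  qed (rule \<sigma>A)
  define \<tau> where "\<tau> = inv_into A \<sigma>"
  have \<tau>A: "\<tau> y \<in> A" and \<sigma>\<tau>: "\<sigma> (\<tau> y) = y" and \<tau>\<sigma>: "\<tau> (\<sigma> y) = y" if "y \<in> A" for y
    using \<sigma>_bij that unfolding \<tau>_def bij_betw_def
    by (auto simp: f_inv_into_f inv_into_into inv_into_f_f)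
  have \<sigma>_act: "\<sigma> (act h y) = act (f h) (\<sigma> y)" if "h \<in> carrier H" "y \<in> A" for h y
    using that rep(1)[OF cQ] by (auto simp: \<sigma>_def act_def A_def f_hom m_assoc)
  have act_closed: "act h y \<in> A" if "h \<in> carrier H" "y \<in> A" for h y
    using that by (auto simp: act_def A_def)
  have act_mult: "act h (act h' y) = act (h \<otimes>\<^bsub>H\<^esub> h') y"
    if "h \<in> carrier H" "h' \<in> carrier H" "y \<in> A" for h h' y
    using that by (auto simp: act_def A_def m_assoc)
  have act_one: "act \<one>\<^bsub>H\<^esub> y = y" if "y \<in> A" for y
    using that by (auto simp: act_def A_def)

  define step where "step = (\<lambda>(x, b). case x of
    Base h \<Rightarrow> act (if b then h else inv\<^bsub>H\<^esub> h) | Stable \<Rightarrow> if b then \<tau> else \<sigma>)"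
  have step_closed: "step l y \<in> A" if "fst l \<in> hnn_gens H" "y \<in> A" for l y
    using that by (cases l) (auto simp: step_def hnn_gens_def act_closed \<tau>A \<sigma>A)
  have word_closed: "foldr step w y \<in> A" if "w \<in> words (hnn_gens H)" "y \<in> A" for w y
    using that by (induction w) (auto simp: step_closed)
  have inv: "foldr step u y = foldr step v y"
    if "(u, v) \<in> pres_rel (hnn_gens H) (hnn_rels H f)" "y \<in> A" for u v y
    using that
  proof (induction arbitrary: y rule: pres_rel.induct)
    case (sym u v)
    show ?case using sym.IH[OF sym.prems] by (rule HOL.sym)
  next
    case (trans u v w)
    show ?case using trans.IH[OF trans.prems] by (rule HOL.trans)
  next
    case (append u v u' v')
    thus ?case using word_closed pres_rel_words[OF append.hyps(2)] by simp
  next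
    case (cancel x b)
    thus ?case
      by (auto simp: step_def hnn_gens_def act_mult act_one \<sigma>\<tau> \<tau>\<sigma>)
  next
    case (relator u v)
    thus ?case
      by (auto simp: step_def hnn_rels_def act_mult \<sigma>_act \<sigma>\<tau> \<tau>A)
  qed (rule HOL.refl)
  show ?thesis
  proof (rule inj_onI)
    fix h h' assume h: "h \<in> carrier H" "h' \<in> carrier H" "hnn_base H f h = hnn_base H f h'"
    hence "([(Base h, True)], [(Base h', True)]) \<in> pres_rel (hnn_gens H) (hnn_rels H f)"
      by (simp add: hnn_base_def pres_class_eq_iff hnn_gens_def)
    from inv[OF this, of "(\<one>\<^bsub>H\<^esub>, 0)"] show "h = h'"
      using h by (simp add: step_def act_def A_def)
  qed
qed

end

theory Submission
  imports Defs
begin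

text \<open>
  A subgroup \<open>Q\<close> is quasi-normal iff each translate \<open>gQ\<close> is covered by finitely many right cosets
  of \<open>Q\<close>. This condition on \<open>g\<close> is stable under products, so it suffices to check it on
  generators. Elements of \<open>H\<close> satisfy \<open>hH = H\<close>; moreover \<open>t\<^sup>-\<^sup>1H = f(H)t\<^sup>-\<^sup>1\<close>, and if
  \<open>H = f(H)E\<close> with \<open>E\<close> finite, then \<open>tH = tf(H)E = H(tE)\<close>. Finally
  \<open>gf(H) \<subseteq> gH \<subseteq> HF \<subseteq> f(H)EF\<close> transfers the condition to \<open>f(H)\<close>.
\<close>

section \<open>Finite index and covers by finitely many right cosets\<close>

text \<open>For \<open>x\<close> in \<open>A\<close>, the coset of \<open>A \<inter> B\<close>
  through \<open>x\<close> is the trace on \<open>A\<close> of the coset \<open>B #> x\<close>. By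
  the cover, that coset is \<open>B #> y\<close> for some \<open>y\<close> in \<open>F\<close>, so
  at most as many cosets occur as \<open>F\<close> has elements.\<close>

lemma (in group) finite_index_Int:
  assumes A: "subgroup A G" and B: "subgroup B G"
    and F: "finite F" "F \<subseteq> carrier G" and cov: "A \<subseteq> B <#> F"
  shows "finite_index (A \<inter> B) A G"
proof -
  have AB: "subgroup (A \<inter> B) G" using A B by (rule subgroups_Inter_pair)
  have "rcosets\<^bsub>G\<lparr>carrier := A\<rparr>\<^esub> (A \<inter> B) \<subseteq> (\<lambda>y. A \<inter> (B #> y)) ` F"
  proof
    fix C assume "C \<in> rcosets\<^bsub>G\<lparr>carrier := A\<rparr>\<^esub> (A \<inter> B)"
    then obtain x where x: "x \<in> A" and C: "C = (A \<inter> B) #> x"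
      by (auto simp: RCOSETS_def r_coset_def)
    obtain y where y: "y \<in> F" "x \<in> B #> y"
      using cov x unfolding set_mult_def r_coset_def by blast
    have xG: "x \<in> carrier G" using x subgroup.mem_carrier[OF A] by blast
    have Bx: "B #> y = B #> x" using y F B by (intro repr_independence) auto
    have "C = A \<inter> (B #> x)"
    proof (intro equalityI subsetI)
      fix z assume "z \<in> C"
      thus "z \<in> A \<inter> (B #> x)"
        using x subgroup.m_closed[OF A] by (auto simp: C r_coset_def)
    next
      fix z assume z: "z \<in> A \<inter> (B #> x)"
      then obtain b where b: "b \<in> B" "z = b \<otimes> x" by (auto simp: r_coset_def)
      \<comment> \<open>Solving for \<open>b\<close> puts it in \<open>A\<close>, because both
        \<open>z\<close> and \<open>x\<close> lie there.\<close>
      have "b = z \<otimes> inv x"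
        using b xG subgroup.mem_carrier[OF B] by (simp add: m_assoc)
      hence "b \<in> A"
        using z x subgroup.m_closed[OF A] subgroup.m_inv_closed[OF A] by simp
      thus "z \<in> C" using b by (auto simp: C r_coset_def)
    qed
    thus "C \<in> (\<lambda>y. A \<inter> (B #> y)) ` F" using y Bx by blast
  qed
  hence "finite (rcosets\<^bsub>G\<lparr>carrier := A\<rparr>\<^esub> (A \<inter> B))"
    using F by (auto intro: finite_subset)
  thus ?thesis
    using A AB by (simp add: finite_index_def subgroup_incl)
qed

text \<open>One representative from each of the finitely many right cosets suffices, since every
  element lies in its own coset.\<close>

lemma (in group) finite_index_cover:
  assumes "finite_index K L G"
  shows "\<exists>F. finite F \<and> F \<subseteq> L \<and> L \<subseteq> K <#> F"
proof -
  let ?Q = "rcosets\<^bsub>G\<lparr>carrier := L\<rparr>\<^esub> K"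
  have L: "subgroup L G" and K: "subgroup K (G\<lparr>carrier := L\<rparr>)" and fin: "finite ?Q"
    using assms by (auto simp: finite_index_def)
  \<comment> \<open>Restricting the carrier leaves the multiplication unchanged, so these are
    ordinary cosets in \<open>G\<close>, with representatives from \<open>L\<close>.\<close>
  have "?Q = (\<lambda>x. K #> x) ` L"
    by (auto simp: RCOSETS_def r_coset_def)
  with fin obtain F where F: "F \<subseteq> L" "finite F" "?Q = (\<lambda>x. K #> x) ` F"
    by (metis finite_subset_image subset_refl)
  have "x \<in> K <#> F" if x: "x \<in> L" for x
  proof -
    have "\<one> \<in> K" using subgroup.one_closed[OF K] by simp
    hence "x \<in> K #> x"
      using x subgroup.mem_carrier[OF L] by (force simp: r_coset_def)
    moreover obtain y where "y \<in> F" "K #> x = K #> y"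
      using F \<open>?Q = (\<lambda>x. K #> x) ` L\<close> x by blast
    ultimately have "y \<in> F" "x \<in> K #> y" by simp_all
    thus ?thesis unfolding set_mult_def r_coset_def by blast
  qed
  with F show ?thesis by blast
qed

lemma (in group) inv_cancel:
  assumes "x \<in> carrier G" "y \<in> carrier G"
  shows "inv x \<otimes> (x \<otimes> y) = y"
  using assms by (simp add: m_assoc[symmetric])

lemma (in group) subgroup_conj_subgroup:
  assumes "subgroup Q G" and g: "g \<in> carrier G"
  shows "subgroup (conj_subgroup G g Q) G"
proof -
  have "(\<lambda>h. g \<otimes> h \<otimes> inv g) \<in> hom G G"
    using g by (intro homI) (auto simp: m_assoc inv_cancel)
  then interpret group_hom G G "\<lambda>h. g \<otimes> h \<otimes> inv g"
    by unfold_locales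
  show ?thesis
    unfolding conj_subgroup_def by (rule subgroup_img_is_subgroup[OF assms(1)])
qed

text \<open>Each of the two indices in the commensurator comes from one cover: the cover for
  \<open>g\<close> bounds the index in the conjugate, and the cover for \<open>inv g\<close> bounds
  the index in \<open>Q\<close>.\<close>

lemma (in group) quasi_normalI:
  assumes Q: "subgroup Q G"
    and cov: "\<And>g. g \<in> carrier G \<Longrightarrow> \<exists>F. finite F \<and> F \<subseteq> carrier G \<and> g <# Q \<subseteq> Q <#> F"
  shows "quasi_normal Q G"
proof -
  have "g \<in> commensurator Q G" if g: "g \<in> carrier G" for g
  proof -
    let ?C = "conj_subgroup G g Q"
    have QG: "q \<in> carrier G" if "q \<in> Q" for q using that subgroup.mem_carrier[OF Q] by blast
    have C: "subgroup ?C G" using Q g by (rule subgroup_conj_subgroup)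
    obtain F where F: "finite F" "F \<subseteq> carrier G" "g <# Q \<subseteq> Q <#> F" using cov[OF g] by blast
    \<comment> \<open>Multiply the cover of \<open>g <# Q\<close> by \<open>inv g\<close> on the
      right.\<close>
    have "?C \<subseteq> Q <#> ((\<lambda>y. y \<otimes> inv g) ` F)"
    proof
      fix x assume "x \<in> ?C"
      then obtain q where q: "q \<in> Q" "x = g \<otimes> q \<otimes> inv g" by (auto simp: conj_subgroup_def)
      have "g \<otimes> q \<in> Q <#> F" using q F(3) by (auto simp: l_coset_def)
      then obtain p y where py: "p \<in> Q" "y \<in> F" "g \<otimes> q = p \<otimes> y" by (auto simp: set_mult_def)
      have "x = p \<otimes> (y \<otimes> inv g)" using q py F(2) QG g by (auto simp: m_assoc)
      thus "x \<in> Q <#> ((\<lambda>y. y \<otimes> inv g) ` F)" using py by (auto simp: set_mult_def)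
    qed
    hence 1: "finite_index (?C \<inter> Q) ?C G"
      using F g by (intro finite_index_Int[OF C Q]) auto
    obtain E where E: "finite E" "E \<subseteq> carrier G" "inv g <# Q \<subseteq> Q <#> E"
      using cov[of "inv g"] g by auto
    \<comment> \<open>Multiply the cover of \<open>inv g <# Q\<close> by \<open>g\<close> on the
      left, then insert \<open>inv g \<otimes> g\<close> between \<open>p\<close> and
      \<open>y\<close> to make the conjugate of \<open>p\<close> appear.\<close>
    have "Q \<subseteq> ?C <#> ((\<lambda>y. g \<otimes> y) ` E)"
    proof
      fix q assume q: "q \<in> Q"
      have "inv g \<otimes> q \<in> Q <#> E" using q E(3) by (auto simp: l_coset_def)
      then obtain p y where py: "p \<in> Q" "y \<in> E" "inv g \<otimes> q = p \<otimes> y" by (auto simp: set_mult_def)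
      have yG: "y \<in> carrier G" using py E(2) by auto
      have "q = g \<otimes> (p \<otimes> y)" using py q g QG by (metis inv_solve_left m_closed yG)
      also have "\<dots> = (g \<otimes> p \<otimes> inv g) \<otimes> (g \<otimes> y)"
        using py g QG yG by (simp add: m_assoc inv_cancel)
      finally show "q \<in> ?C <#> ((\<lambda>y. g \<otimes> y) ` E)"
        using py by (auto simp: set_mult_def conj_subgroup_def)
    qed
    hence "finite_index (Q \<inter> ?C) Q G"
      using E g by (intro finite_index_Int[OF Q C]) auto
    with 1 g show ?thesis by (simp add: commensurator_def Int_commute)
  qed
  thus ?thesis using Q by (auto simp: quasi_normal_def commensurator_def)
qed

section \<open>Generators of a presented group\<close>

text \<open>Every element is the class of a word, and a word is built by prepending letters. The
  Boolean \<open>b\<close> ranges over both signs, so the step also treats formal inverses.\<close>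

lemma presented_group_induct [consumes 1, case_names one mult]:
  assumes "A \<in> carrier (presented_group S R)"
    and "P \<one>\<^bsub>presented_group S R\<^esub>"
    and step: "\<And>x b B. x \<in> S \<Longrightarrow> B \<in> carrier (presented_group S R) \<Longrightarrow> P B \<Longrightarrow>
      P (pres_class S R [(x, b)] \<otimes>\<^bsub>presented_group S R\<^esub> B)"
  shows "P A"
proof -
  obtain w where "w \<in> words S" "A = pres_class S R w"
    using assms(1) by (auto simp: pres_carrier)
  moreover have "P (pres_class S R w)" if "w \<in> words S" for w
    using that
  proof (induction w)
    case Nil
    show ?case using assms(2) by (simp add: pres_one)
  next
    case (Cons a w)
    obtain x b where a: "a = (x, b)" by (cases a)
    have x: "x \<in> S" and w: "w \<in> words S" using Cons.prems a by simp_all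
    have "P (pres_class S R [(x, b)] \<otimes>\<^bsub>presented_group S R\<^esub> pres_class S R w)"
      using w by (intro step[OF x _ Cons.IH[OF w]]) (auto simp: pres_carrier)
    thus ?case using x w by (simp add: a pres_mult)
  qed
  ultimately show ?thesis by simp
qed

text \<open>The cancellation relation makes the formal inverse a left inverse, which determines it
  in a group.\<close>

lemma pres_class_inverse_letter:
  assumes "x \<in> S"
  shows "pres_class S R [(x, False)] = inv\<^bsub>presented_group S R\<^esub> (pres_class S R [(x, True)])"
proof -
  interpret group "presented_group S R" by (rule group_presented_group)
  have "pres_class S R [(x, False)] \<otimes>\<^bsub>presented_group S R\<^esub> pres_class S R [(x, True)]
      = \<one>\<^bsub>presented_group S R\<^esub>"
    using assms pres_rel.cancel[OF assms, of False R] by (simp add: pres_mult pres_one pres_class_eq_iff)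
  thus ?thesis
    using assms by (intro inv_equality[symmetric]) (auto simp: pres_carrier)
qed

section \<open>Quasi-normality in the ascending HNN extension\<close>

theorem lemma14:
  fixes H :: "('a, 'b) monoid_scheme" and f :: "'a \<Rightarrow> 'a"
  assumes "group H"
    and "f \<in> mon H H"
    and "finite_index (f ` carrier H) (carrier H) H"
  shows "quasi_normal (hnn_base H f ` carrier H) (ascending_HNN H f) \<and>
         quasi_normal (hnn_base H f ` f ` carrier H) (ascending_HNN H f)"
proof -
  interpret H: group H by fact
  define G where "G = ascending_HNN H f"
  interpret G: group G unfolding G_def by (rule group_ascending_HNN)
  define i where "i = hnn_base H f"
  interpret i: group_hom H G i
    using hnn_base_hom[OF assms(1)] by unfold_locales (simp add: i_def G_def)
  define t where "t = pres_class (hnn_gens H) (hnn_rels H f) [(Stable, True)]"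
  define K where "K = i ` carrier H"
  define L where "L = i ` f ` carrier H"
  have f_closed: "f h \<in> carrier H" if "h \<in> carrier H" for h
    using assms(2) that by (auto simp: mon_def hom_def)
  have subH: "subgroup (f ` carrier H) H"
    using assms(3) by (simp add: finite_index_def)
  have K: "subgroup K G" and L: "subgroup L G"
    unfolding K_def L_def using i.subgroup_img_is_subgroup H.subgroup_self subH by blast+
  have LK: "L \<subseteq> K" using f_closed by (auto simp: K_def L_def)
  have KG: "k \<in> carrier G" if "k \<in> K" for k using that by (auto simp: K_def)
  have tG: "t \<in> carrier G"
    by (auto simp: t_def G_def ascending_HNN_def pres_carrier hnn_gens_def)
  have inv_letter: "pres_class (hnn_gens H) (hnn_rels H f) [(x, False)]
      = inv\<^bsub>G\<^esub> pres_class (hnn_gens H) (hnn_rels H f) [(x, True)]" if "x \<in> hnn_gens H" for x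
    using that by (simp add: G_def ascending_HNN_def pres_class_inverse_letter)
  \<comment> \<open>The defining relator for \<open>Stable\<close>, read as an equation between
    classes.\<close>
  have conj: "inv\<^bsub>G\<^esub> t \<otimes>\<^bsub>G\<^esub> i h \<otimes>\<^bsub>G\<^esub> t = i (f h)" if h: "h \<in> carrier H" for h
  proof -
    have "([(Stable, False), (Base h, True), (Stable, True)], [(Base (f h), True)])
        \<in> pres_rel (hnn_gens H) (hnn_rels H f)"
      by (rule pres_rel.relator) (use h f_closed in \<open>auto simp: hnn_gens_def hnn_rels_def\<close>)
    moreover have "inv\<^bsub>G\<^esub> t = pres_class (hnn_gens H) (hnn_rels H f) [(Stable, False)]"
      using inv_letter[of Stable] by (simp add: t_def hnn_gens_def)
    ultimately show ?thesis
      using h f_closed by (simp add: t_def i_def G_def ascending_HNN_def hnn_base_def pres_mult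
          pres_class_eq_iff hnn_gens_def)
  qed

  obtain E where E: "finite E" "E \<subseteq> carrier G" "K \<subseteq> L <#>\<^bsub>G\<^esub> E"
  proof -
    obtain F where F: "finite F" "F \<subseteq> carrier H" "carrier H \<subseteq> f ` carrier H <#>\<^bsub>H\<^esub> F"
      using H.finite_index_cover[OF assms(3)] by blast
    have "K \<subseteq> L <#>\<^bsub>G\<^esub> i ` F"
    proof
      fix k assume "k \<in> K"
      then obtain h where h: "h \<in> carrier H" "k = i h" by (auto simp: K_def)
      then obtain a y where a: "a \<in> carrier H" "y \<in> F" "h = f a \<otimes>\<^bsub>H\<^esub> y"
        using F(3) by (auto simp: set_mult_def)
      hence "k = i (f a) \<otimes>\<^bsub>G\<^esub> i y" using h F(2) f_closed by auto
      thus "k \<in> L <#>\<^bsub>G\<^esub> i ` F"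
        using a by (auto simp: L_def set_mult_def)
    qed
    moreover have "i ` F \<subseteq> carrier G" using F(2) i.hom_closed by blast
    ultimately show ?thesis using F(1) that[of "i ` F"] by blast
  qed

  define cov where "cov g \<longleftrightarrow> (\<exists>F. finite F \<and> F \<subseteq> carrier G \<and> g <#\<^bsub>G\<^esub> K \<subseteq> K <#>\<^bsub>G\<^esub> F)" for g
  \<comment> \<open>Here \<open>g <# K\<close> stays inside \<open>K\<close>, so the unit alone is a
    sufficient set of representatives.\<close>
  have cov_base: "cov g" if "g \<in> K" for g
    unfolding cov_def
  proof (intro exI conjI)
    show "g <#\<^bsub>G\<^esub> K \<subseteq> K <#>\<^bsub>G\<^esub> {\<one>\<^bsub>G\<^esub>}"
      using that K KG subgroup.m_closed[OF K] by (force simp: l_coset_def set_mult_def)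
  qed auto
  have cov_t_inv: "cov (inv\<^bsub>G\<^esub> t)"
    unfolding cov_def
  proof (intro exI conjI)
    show "inv\<^bsub>G\<^esub> t <#\<^bsub>G\<^esub> K \<subseteq> K <#>\<^bsub>G\<^esub> {inv\<^bsub>G\<^esub> t}"
    proof
      fix x assume "x \<in> inv\<^bsub>G\<^esub> t <#\<^bsub>G\<^esub> K"
      then obtain h where h: "h \<in> carrier H" "x = inv\<^bsub>G\<^esub> t \<otimes>\<^bsub>G\<^esub> i h"
        by (auto simp: l_coset_def K_def)
      \<comment> \<open>Expanding \<open>i (f h)\<close> as a conjugate of \<open>i h\<close> leaves
        \<open>t\<close> next to its inverse. Thus the single representative \<open>inv t\<close> is
        enough.\<close>
      have "x = i (f h) \<otimes>\<^bsub>G\<^esub> inv\<^bsub>G\<^esub> t"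
        using h tG by (simp add: conj[symmetric] G.m_assoc)
      thus "x \<in> K <#>\<^bsub>G\<^esub> {inv\<^bsub>G\<^esub> t}"
        using h f_closed by (auto simp: K_def set_mult_def)
    qed
  qed (use tG in auto)
  have cov_t: "cov t"
    unfolding cov_def
  proof (intro exI conjI)
    show "t <#\<^bsub>G\<^esub> K \<subseteq> K <#>\<^bsub>G\<^esub> (\<lambda>e. t \<otimes>\<^bsub>G\<^esub> e) ` E"
    proof
      fix x assume "x \<in> t <#\<^bsub>G\<^esub> K"
      then obtain k where k: "k \<in> K" "x = t \<otimes>\<^bsub>G\<^esub> k" by (auto simp: l_coset_def)
      then obtain h e where he: "h \<in> carrier H" "e \<in> E" "k = i (f h) \<otimes>\<^bsub>G\<^esub> e"
        using E(3) by (auto simp: L_def set_mult_def)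
      have eG: "e \<in> carrier G" using he E by blast
      \<comment> \<open>Only elements of \<open>L\<close> can be moved past \<open>t\<close> from
        right to left in this way; the remaining factor \<open>e\<close> stays behind and joins the
        representative \<open>t \<otimes> e\<close>.\<close>
      have "t \<otimes>\<^bsub>G\<^esub> i (f h) = i h \<otimes>\<^bsub>G\<^esub> t"
        using he tG by (simp add: conj[symmetric] G.m_assoc[symmetric])
      hence "x = i h \<otimes>\<^bsub>G\<^esub> (t \<otimes>\<^bsub>G\<^esub> e)"
        using k he tG eG f_closed by (simp add: G.m_assoc[symmetric])
      thus "x \<in> K <#>\<^bsub>G\<^esub> (\<lambda>e. t \<otimes>\<^bsub>G\<^esub> e) ` E"
        using he by (auto simp: K_def set_mult_def)
    qed
  qed (use E tG in auto)
  \<comment> \<open>The two covers compose: gg'K \<subseteq> gKF' \<subseteq> KFF', and the product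
    set FF' is again finite.\<close>
  have cov_mult: "cov (g \<otimes>\<^bsub>G\<^esub> g')"
    if g: "g \<in> carrier G" "g' \<in> carrier G" and "cov g" "cov g'" for g g'
  proof -
    obtain F F' where F: "finite F" "F \<subseteq> carrier G" "g <#\<^bsub>G\<^esub> K \<subseteq> K <#>\<^bsub>G\<^esub> F"
      and F': "finite F'" "F' \<subseteq> carrier G" "g' <#\<^bsub>G\<^esub> K \<subseteq> K <#>\<^bsub>G\<^esub> F'"
      using \<open>cov g\<close> \<open>cov g'\<close> unfolding cov_def by blast
    have KS: "K \<subseteq> carrier G" using KG by blast
    have "(g \<otimes>\<^bsub>G\<^esub> g') <#\<^bsub>G\<^esub> K = g <#\<^bsub>G\<^esub> (g' <#\<^bsub>G\<^esub> K)"
      using g KS by (simp add: G.lcos_m_assoc)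
    also have "\<dots> \<subseteq> g <#\<^bsub>G\<^esub> (K <#>\<^bsub>G\<^esub> F')"
      using F'(3) by (auto simp: l_coset_def)
    also have "\<dots> = (g <#\<^bsub>G\<^esub> K) <#>\<^bsub>G\<^esub> F'"
      using g KS F'(2) by (simp add: l_coset_eq_set_mult G.set_mult_assoc)
    also have "\<dots> \<subseteq> (K <#>\<^bsub>G\<^esub> F) <#>\<^bsub>G\<^esub> F'"
      by (rule mono_set_mult[OF F(3) subset_refl])
    also have "\<dots> = K <#>\<^bsub>G\<^esub> (F <#>\<^bsub>G\<^esub> F')"
      using KS F(2) F'(2) by (simp add: G.set_mult_assoc)
    finally have "(g \<otimes>\<^bsub>G\<^esub> g') <#\<^bsub>G\<^esub> K \<subseteq> K <#>\<^bsub>G\<^esub> (F <#>\<^bsub>G\<^esub> F')" .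
    moreover have "finite (F <#>\<^bsub>G\<^esub> F')" using F F' by (auto simp: set_mult_def)
    moreover have "F <#>\<^bsub>G\<^esub> F' \<subseteq> carrier G" using F F' by (intro G.set_mult_closed)
    ultimately show ?thesis unfolding cov_def by blast
  qed
  have cov: "cov g" if "g \<in> carrier G" for g
    using that unfolding G_def ascending_HNN_def
  proof (induction rule: presented_group_induct)
    case one
    show ?case
      using cov_base[OF subgroup.one_closed[OF K]] by (simp add: G_def ascending_HNN_def)
  next
    case (mult x b B)
    let ?x = "pres_class (hnn_gens H) (hnn_rels H f) [(x, b)]"
    \<comment> \<open>A base letter of either sign lies in the subgroup \<open>K\<close>; a stable
      letter is \<open>t\<close> or its inverse.\<close>
    have "cov ?x"
    proof (cases x)
      case (Base h)
      hence k: "pres_class (hnn_gens H) (hnn_rels H f) [(x, True)] \<in> K"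
        using mult(1) by (auto simp: hnn_gens_def K_def i_def hnn_base_def)
      hence "?x \<in> K"
        using inv_letter[OF mult(1)] subgroup.m_inv_closed[OF K k] by (cases b) simp_all
      thus ?thesis by (rule cov_base)
    next
      case Stable
      thus ?thesis
        using cov_t cov_t_inv inv_letter[OF mult(1)] by (cases b) (simp_all add: t_def)
    qed
    moreover have "?x \<in> carrier G"
      using mult(1) by (auto simp: G_def ascending_HNN_def pres_carrier)
    ultimately show ?case
      using cov_mult[of ?x B] mult by (simp add: G_def ascending_HNN_def)
  qed

  have "quasi_normal K G"
    using cov by (intro G.quasi_normalI K) (simp add: cov_def)
  moreover have "quasi_normal L G"
  proof (intro G.quasi_normalI L)
    fix g assume "g \<in> carrier G"
    then obtain F where F: "finite F" "F \<subseteq> carrier G" "g <#\<^bsub>G\<^esub> K \<subseteq> K <#>\<^bsub>G\<^esub> F"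
      using cov unfolding cov_def by blast
    have "g <#\<^bsub>G\<^esub> L \<subseteq> g <#\<^bsub>G\<^esub> K" using LK by (auto simp: l_coset_def)
    also note F(3)
    \<comment> \<open>Each coset of \<open>K\<close> is replaced by finitely many cosets of
      \<open>L\<close>, so the product of \<open>E\<close> and \<open>F\<close> represents the cover
      for \<open>L\<close>.\<close>
    also have "K <#>\<^bsub>G\<^esub> F \<subseteq> (L <#>\<^bsub>G\<^esub> E) <#>\<^bsub>G\<^esub> F"
      by (rule mono_set_mult[OF E(3) subset_refl])
    also have "\<dots> = L <#>\<^bsub>G\<^esub> (E <#>\<^bsub>G\<^esub> F)"
      using subgroup.subset[OF L] E(2) F(2) by (simp add: G.set_mult_assoc)
    finally show "\<exists>F. finite F \<and> F \<subseteq> carrier G \<and> g <#\<^bsub>G\<^esub> L \<subseteq> L <#>\<^bsub>G\<^esub> F"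
      using E F G.set_mult_closed[OF E(2) F(2)] by (intro exI[of _ "E <#>\<^bsub>G\<^esub> F"]) (auto simp: set_mult_def)
  qed
  ultimately show ?thesis
    by (simp add: K_def L_def i_def G_def)
qed

end
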